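(* Let $T$ be a continuous bundle random dynamical system over $(\Omega,\mathcal{F},\mathbb{P},\vartheta)$ with bundle $\mathcal{E}\subset\Omega\times X$. If $T$ has finite topological entropy, i.e. $h_{\mathrm{top}}(T)<\infty$, then $\mathrm{mdim}(T)=0$.
   Context: Setting. $(\Omega,\mathcal{F},\mathbb{P})$ is a complete probability space, $\vartheta:\Omega\to\Omega$ is a $\mathbb{P}$-preserving transformation, $(X,d)$ is a compact metric space with Borel $\sigma$-algebra $\mathcal{B}$. $\mathcal{E}\subset\Omega\times X$ is measurable with respect to $\mathcal{F}\otimes\mathcal{B}$ and its fibers $\mathcal{E}_\omega=\{x\in X:(\omega,x)\in\mathcal{E}\}$ are nonempty compact subsets of $X$. A continuous bundle random dynamical system (RDS) $T$ over $(\Omega,\mathcal{F},\mathbb{P},\vartheta)$ is given by maps $T_\omega:\mathcal{E}_\omega\to\mathcal{E}_{\vartheta\omega}$ such that $(\omega,x)\mapsto T_\omega x$ is measurable and $x\mapsto T_\omega x$ is continuous for $\mathbb{P}$-almost all $\omega$. Put $T^n_\omega=T_{\vartheta^{n-1}\omega}\circ\cdots\circ T_{\vartheta\omega}\circ T_\omega$ for $n\ge1$ and $T^0_\omega=\mathrm{id}$. $\mathbb{E}$ denotes expectation with respect to $\mathbb{P}$. Covers. For a finite open cover $\alpha$ of a compact set $K\subset X$, $\mathrm{ord}(\alpha)=-1+\sup_{x\in K}\sum_{U\in\alpha}1_U(x)$ and $\mathcal{D}(\alpha)=\min_{\beta\succ\alpha}\mathrm{ord}(\beta)$, where $\beta$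 runs over all finite open covers of $K$ refining $\alpha$ (every member of $\beta$ is contained in a member of $\alpha$). For a finite open cover $\alpha$ of $X$, $\alpha(\omega|\mathcal{E})=\{A\cap\mathcal{E}_\omega:A\in\alpha\}$ is an open cover of $\mathcal{E}_\omega$, and $\alpha_0^{n-1}(\omega|\mathcal{E})=\bigvee_{i=0}^{n-1}(T^i_\omega)^{-1}\alpha(\vartheta^i\omega|\mathcal{E})$ is the open cover of $\mathcal{E}_\omega$ by all sets $\bigcap_{i=0}^{n-1}(T^i_\omega)^{-1}(A_i\cap\mathcal{E}_{\vartheta^i\omega})$ with $A_i\in\alpha$. Mean topological dimension. $\mathrm{mdim}(T,\alpha)=\lim_{n\to\infty}\frac1n\,\mathbb{E}\,\mathcal{D}(\alpha_0^{n-1}(\omega|\mathcal{E}))$ (the limit exists), and $\mathrm{mdim}(T)=\sup_\alpha\mathrm{mdim}(T,\alpha)$ over all finite open covers $\alpha$ of $X$. Topological entropy. For a constant $\epsilon>0$ and $n\ge1$ let $d^\omega_{\epsilon,n}(x,y)=\max_{0\le k<n}d(T^k_\omega x,T^k_\omega y)/\epsilon$ for $x,y\in\mathcal{E}_\omega$, and let $\mathrm{sep}(\omega,\epsilon,n)$ be the maximal cardinality of a set $F\subset\mathcal{E}_\omega$ such that $d^\omega_{\epsilon,n}(x,y)\ge1$ for all distinct $x,y\in F$. Put $S'(\omega,\epsilon)=\limsup_{n\to\infty}\frac1n\log\mathrm{sep}(\omega,\epsilon,n)$; then $h_{\mathrm{top}}(T)=\mathbb{E}\lim_{\epsilon\to0}S'(\omega,\epsilon)$.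 *)

theory Defs
  imports "HOL-Probability.Probability"
begin

text \<open>Covers of a set \<open>K\<close> are families of relatively open subsets of \<open>K\<close>.\<close>

definition finite_open_cover :: "'x::topological_space set \<Rightarrow> 'x set set \<Rightarrow> bool" where
  "finite_open_cover K \<alpha> \<longleftrightarrow>
     finite \<alpha> \<and> (\<forall>U\<in>\<alpha>. openin (top_of_set K) U) \<and> \<Union>\<alpha> = K"

definition refines :: "'x set set \<Rightarrow> 'x set set \<Rightarrow> bool" (infix "refines" 50) where
  "\<beta> refines \<alpha> \<longleftrightarrow> (\<forall>V\<in>\<beta>. \<exists>U\<in>\<alpha>. V \<subseteq> U)"

text \<open>The supremum is that of a bounded set of naturals when \<open>\<alpha>\<close> is finite, and it is at least 1
  when \<open>\<alpha>\<close> covers \<open>K \<noteq> {}\<close>, so that the subtraction does not truncate.\<close>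

definition cover_ord :: "'x set \<Rightarrow> 'x set set \<Rightarrow> nat" where
  "cover_ord K \<alpha> = (SUP x\<in>K. \<Sum>U\<in>\<alpha>. indicator U x) - 1"

text \<open>The infimum is attained: \<open>\<alpha>\<close> refines itself, so this is the infimum of a nonempty
  set of naturals whenever \<open>\<alpha>\<close> is a finite open cover of \<open>K\<close>.\<close>

definition cover_dim :: "'x::topological_space set \<Rightarrow> 'x set set \<Rightarrow> nat" where
  "cover_dim K \<alpha> = (INF \<beta>\<in>{\<beta>. finite_open_cover K \<beta> \<and> \<beta> refines \<alpha>}. cover_ord K \<beta>)"

definition fiber :: "('w \<times> 'x) set \<Rightarrow> 'w \<Rightarrow> 'x set" where
  "fiber \<E> \<omega> = {x. (\<omega>, x) \<in> \<E>}"

text \<open>The compact metric space is the whole type \<open>'x\<close>. Only the values of \<open>T \<omega>\<close> on the fiber over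
  \<open>\<omega>\<close> matter.\<close>

locale continuous_bundle_rds = prob_space M + complete_measure M
  for M :: "'w measure" +
  fixes \<theta> :: "'w \<Rightarrow> 'w"
    and \<E> :: "('w \<times> 'x::metric_space) set"
    and T :: "'w \<Rightarrow> 'x \<Rightarrow> 'x"
  assumes compact_space: "compact (UNIV :: 'x set)"
    and base_measurable: "\<theta> \<in> M \<rightarrow>\<^sub>M M"
    and base_preserving: "distr M M \<theta> = M"
    and bundle_measurable: "\<E> \<in> sets (M \<Otimes>\<^sub>M borel)"
    and fiber_nonempty: "\<And>\<omega>. \<omega> \<in> space M \<Longrightarrow> fiber \<E> \<omega> \<noteq> {}"
    and fiber_compact: "\<And>\<omega>. \<omega> \<in> space M \<Longrightarrow> compact (fiber \<E> \<omega>)"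
    and maps_fiber: "\<And>\<omega>. \<omega> \<in> space M \<Longrightarrow> T \<omega> \<in> fiber \<E> \<omega> \<rightarrow> fiber \<E> (\<theta> \<omega>)"
    and rds_measurable: "(\<lambda>(\<omega>, x). T \<omega> x) \<in> restrict_space (M \<Otimes>\<^sub>M borel) \<E> \<rightarrow>\<^sub>M borel"
    and rds_continuous: "AE \<omega> in M. continuous_on (fiber \<E> \<omega>) (T \<omega>)"

primrec rds_iter :: "('w \<Rightarrow> 'w) \<Rightarrow> ('w \<Rightarrow> 'x \<Rightarrow> 'x) \<Rightarrow> nat \<Rightarrow> 'w \<Rightarrow> 'x \<Rightarrow> 'x" where
  "rds_iter \<theta> T 0 \<omega> = id"
| "rds_iter \<theta> T (Suc n) \<omega> = T ((\<theta> ^^ n) \<omega>) \<circ> rds_iter \<theta> T n \<omega>"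

definition iterated_cover ::
  "('w \<Rightarrow> 'w) \<Rightarrow> ('w \<times> 'x) set \<Rightarrow> ('w \<Rightarrow> 'x \<Rightarrow> 'x) \<Rightarrow> 'x set set \<Rightarrow> nat \<Rightarrow> 'w \<Rightarrow> 'x set set" where
  "iterated_cover \<theta> \<E> T \<alpha> n \<omega> =
     {fiber \<E> \<omega> \<inter> (\<Inter>i<n. rds_iter \<theta> T i \<omega> -` (A i \<inter> fiber \<E> ((\<theta> ^^ i) \<omega>))) | A.
        \<forall>i<n. A i \<in> \<alpha>}"

definition mdim_cover ::
  "'w measure \<Rightarrow> ('w \<Rightarrow> 'w) \<Rightarrow> ('w \<times> 'x::metric_space) set \<Rightarrow> ('w \<Rightarrow> 'x \<Rightarrow> 'x)
     \<Rightarrow> 'x set set \<Rightarrow> ennreal" where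
  "mdim_cover M \<theta> \<E> T \<alpha> =
     lim (\<lambda>n. (\<integral>\<^sup>+\<omega>. of_nat (cover_dim (fiber \<E> \<omega>) (iterated_cover \<theta> \<E> T \<alpha> n \<omega>)) \<partial>M) / of_nat n)"

definition mdim ::
  "'w measure \<Rightarrow> ('w \<Rightarrow> 'w) \<Rightarrow> ('w \<times> 'x::metric_space) set \<Rightarrow> ('w \<Rightarrow> 'x \<Rightarrow> 'x) \<Rightarrow> ennreal" where
  "mdim M \<theta> \<E> T = (SUP \<alpha>\<in>{\<alpha>. finite_open_cover UNIV \<alpha>}. mdim_cover M \<theta> \<E> T \<alpha>)"

definition bowen_dist ::
  "('w \<Rightarrow> 'w) \<Rightarrow> ('w \<Rightarrow> 'x \<Rightarrow> 'x::metric_space) \<Rightarrow> 'w \<Rightarrow> real \<Rightarrow> nat \<Rightarrow> 'x \<Rightarrow> 'x \<Rightarrow> real" where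
  "bowen_dist \<theta> T \<omega> \<epsilon> n x y =
     (MAX k\<in>{..<n}. dist (rds_iter \<theta> T k \<omega> x) (rds_iter \<theta> T k \<omega> y) / \<epsilon>)"

text \<open>Whenever the maps along the orbit of \<open>\<omega>\<close> are continuous (hence for almost every \<open>\<omega>\<close>),
  compactness of the fiber bounds the cardinalities, so that for \<open>\<epsilon> > 0\<close> and \<open>n \<ge> 1\<close> the
  supremum is a maximum, and it is at least 1. This makes the values of \<open>ennreal\<close> below
  untruncated.\<close>

definition sep_number ::
  "('w \<Rightarrow> 'w) \<Rightarrow> ('w \<times> 'x) set \<Rightarrow> ('w \<Rightarrow> 'x \<Rightarrow> 'x::metric_space) \<Rightarrow> 'w \<Rightarrow> real \<Rightarrow> nat \<Rightarrow> nat" where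
  "sep_number \<theta> \<E> T \<omega> \<epsilon> n =
     (SUP F\<in>{F. finite F \<and> F \<subseteq> fiber \<E> \<omega> \<and>
                (\<forall>x\<in>F. \<forall>y\<in>F. x \<noteq> y \<longrightarrow> bowen_dist \<theta> T \<omega> \<epsilon> n x y \<ge> 1)}. card F)"

definition sep_growth ::
  "('w \<Rightarrow> 'w) \<Rightarrow> ('w \<times> 'x) set \<Rightarrow> ('w \<Rightarrow> 'x \<Rightarrow> 'x::metric_space) \<Rightarrow> 'w \<Rightarrow> real \<Rightarrow> ennreal" where
  "sep_growth \<theta> \<E> T \<omega> \<epsilon> = limsup (\<lambda>n. ennreal (ln (real (sep_number \<theta> \<E> T \<omega> \<epsilon> n)) / real n))"

definition top_entropy ::
  "'w measure \<Rightarrow> ('w \<Rightarrow> 'w) \<Rightarrow> ('w \<times> 'x::metric_space) set \<Rightarrow> ('w \<Rightarrow> 'x \<Rightarrow> 'x) \<Rightarrow> ennreal" where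
  "top_entropy M \<theta> \<E> T = (\<integral>\<^sup>+\<omega>. Lim (at_right 0) (sep_growth \<theta> \<E> T \<omega>) \<partial>M)"

end

theory Submission
  imports Defs
begin

text \<open>Fix a base point \<open>\<omega>\<close> and compose Lipschitz functions subordinate to \<open>\<alpha>\<close> with
  the iterates \<open>T\<^sup>i\<close>, \<open>i < n\<close>. If the entropy at \<open>\<omega>\<close> is finite, then for a small scale \<open>\<epsilon>\<close> the fiber is covered by
  so few Bowen balls that one can choose levels, one per function, such that no point is within
  \<open>\<epsilon>\<close> of more than \<open>\<delta>n\<close> of them (in place of the measure-theoretic choice of
  Lindenstrauss and Weiss). Cutting the fiber along these levels gives a refinement of order at most
  \<open>\<delta>n\<close>. Hence the integrands \<open>\<D>/n\<close> tend to 0 wherever the entropy is finite,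
  and they are bounded by \<open>card \<alpha>\<close>.\<close>

section \<open>Lipschitz functions subordinate to an open cover\<close>

text \<open>\<open>\<rho>\<close> plays the part of a Lebesgue number, and the superlevel sets of
  the functions at height \<open>\<rho>\<close> cover the space. The Lipschitz constant 1 lets
  orbits that are \<open>\<epsilon>\<close>-close have \<open>\<epsilon>\<close>-close function
  values, with no modulus of continuity to track.\<close>

definition lebesgue_family ::
  "'x::metric_space set set \<Rightarrow> real \<Rightarrow> ('x set \<Rightarrow> 'x \<Rightarrow> real) \<Rightarrow> bool" where
  "lebesgue_family \<alpha> \<rho> f \<longleftrightarrow> 0 < \<rho> \<and> (\<forall>A x y. \<bar>f A x - f A y\<bar> \<le> dist x y) \<and>
     (\<forall>A x. 0 < f A x \<longrightarrow> x \<in> A) \<and> (\<forall>x. \<exists>A\<in>\<alpha>. \<rho> \<le> f A x)"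

lemma lebesgue_familyD:
  assumes "lebesgue_family \<alpha> \<rho> f"
  shows "0 < \<rho>" and "\<bar>f A x - f A y\<bar> \<le> dist x y" and "0 < f A x \<Longrightarrow> x \<in> A"
    and "\<exists>A\<in>\<alpha>. \<rho> \<le> f A x"
  using assms by (auto simp: lebesgue_family_def)

text \<open>The distance to the complement of \<open>A\<close> is 1-Lipschitz and vanishes off
  \<open>A\<close>; at \<open>x\<close> it is at least the Lebesgue number whenever the ball of that
  radius about \<open>x\<close> lies in \<open>A\<close>.\<close>

lemma ex_lebesgue_family:
  fixes \<alpha> :: "'x::metric_space set set"
  assumes "compact (UNIV :: 'x set)" and "finite_open_cover UNIV \<alpha>"
  shows "\<exists>\<rho> f. lebesgue_family \<alpha> \<rho> f"
proof -
  have "open U" if "U \<in> \<alpha>" for U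
    using assms(2) that by (auto simp: finite_open_cover_def)
  moreover have "UNIV \<subseteq> \<Union>\<alpha>"
    using assms(2) by (auto simp: finite_open_cover_def)
  ultimately obtain \<rho> where \<rho>: "0 < \<rho>" "\<And>x. \<exists>A\<in>\<alpha>. ball x \<rho> \<subseteq> A"
    using Heine_Borel_lemma[OF assms(1)] by (metis UNIV_I)
  \<comment> \<open>\<open>infdist\<close> to the empty set is 0 by convention, so the whole space
    gets the constant \<open>\<rho>\<close> instead.\<close>
  define f where "f A x = (if A = UNIV then \<rho> else infdist x (- A))" for A and x :: 'x
  have "lebesgue_family \<alpha> \<rho> f"
    unfolding lebesgue_family_def
  proof (intro conjI allI impI)
    fix A and x y :: 'x
    show "\<bar>f A x - f A y\<bar> \<le> dist x y"
      using infdist_triangle_abs[of x "- A" y] by (simp add: f_def)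
  next
    fix A and x :: 'x
    assume "0 < f A x"
    then show "x \<in> A"
      by (cases "x \<in> A") (auto simp: f_def split: if_splits)
  next
    fix x :: 'x
    obtain A where A: "A \<in> \<alpha>" "ball x \<rho> \<subseteq> A" using \<rho>(2) by blast
    have "\<rho> \<le> infdist x (- A)" if "A \<noteq> UNIV"
    proof -
      have "- A \<noteq> {}" using that by auto
      moreover have "\<rho> \<le> dist x y" if "y \<in> - A" for y
        using A(2) that by (auto simp: subset_iff not_less[symmetric])
      ultimately show ?thesis by (subst infdist_notempty) (auto intro: cINF_greatest)
    qed
    then show "\<exists>A\<in>\<alpha>. \<rho> \<le> f A x" using A(1) by (auto simp: f_def)
  qed (fact \<rho>(1))
  then show ?thesis by blast
qed

section \<open>Refinements of small order from level sets\<close>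

lemma cover_ord_le:
  assumes "K \<noteq> {}" and "finite \<beta>"
    and "\<And>x. x \<in> K \<Longrightarrow> card {U\<in>\<beta>. x \<in> U} \<le> Suc m"
  shows "cover_ord K \<beta> \<le> m"
proof -
  have "(\<Sum>U\<in>\<beta>. indicator U x) = card {U\<in>\<beta>. x \<in> U}" for x
  proof -
    have "(\<Sum>U\<in>\<beta>. indicator U x :: nat) = (\<Sum>U\<in>\<beta>. if x \<in> U then 1 else 0)"
      by (intro sum.cong) (auto simp: indicator_def)
    then show ?thesis using assms(2) by (simp add: sum.If_cases Int_def)
  qed
  then have "(SUP x\<in>K. \<Sum>U\<in>\<beta>. indicator U x :: nat) \<le> Suc m"
    using assms by (intro cSUP_least) auto
  then show ?thesis unfolding cover_ord_def by linarith
qed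

text \<open>For each of \<open>m + 1\<close> distinct radii \<open>t r \<le> \<eta>\<close>, the sets on which every \<open>F c\<close> stays on one side of
  the two points \<open>\<xi> c \<plusminus> t r\<close> are pairwise disjoint. They miss \<open>x\<close> only if some \<open>F c x\<close> is at
  distance exactly \<open>t r\<close> from \<open>\<xi> c\<close>, which by pigeonhole cannot happen for all the radii.\<close>

lemma cover_dim_le_of_few_near_levels:
  fixes F :: "'c \<Rightarrow> 'x::metric_space \<Rightarrow> real"
  assumes "finite C" and "K \<noteq> {}" and "0 < \<eta>"
    and cont: "\<And>c. c \<in> C \<Longrightarrow> continuous_on K (F c)"
    and near: "\<And>x. x \<in> K \<Longrightarrow> card {c\<in>C. \<bar>F c x - \<xi> c\<bar> \<le> \<eta>} \<le> m"
    and refine: "\<And>V. V \<subseteq> K \<Longrightarrow>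
      (\<And>c. c \<in> C \<Longrightarrow> (\<forall>x\<in>V. \<xi> c - \<eta> < F c x) \<or> (\<forall>x\<in>V. F c x < \<xi> c)) \<Longrightarrow> \<exists>U\<in>\<gamma>. V \<subseteq> U"
  shows "cover_dim K \<gamma> \<le> m"
proof -
  define t where "t r = \<eta> * real (Suc r) / real (Suc m)" for r
  have t_pos: "0 < t r" for r using \<open>0 < \<eta>\<close> by (simp add: t_def)
  have t_le: "t r \<le> \<eta>" if "r \<le> m" for r
    using that \<open>0 < \<eta>\<close> by (simp add: t_def divide_simps)
  have t_inj: "inj_on t {..m}"
    using \<open>0 < \<eta>\<close> by (auto simp: inj_on_def t_def)
  define J where
    "J r c = {{..<\<xi> c - t r}, {\<xi> c - t r<..<\<xi> c + t r}, {\<xi> c + t r<..}}" for r c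
  define V where "V s = {x\<in>K. \<forall>c\<in>C. F c x \<in> s c}" for s :: "'c \<Rightarrow> real set"
  define \<beta> where "\<beta> = (\<Union>r\<le>m. V ` Pi\<^sub>E C (J r))"
  have J_disj: "a = b" if "a \<in> J r c" "b \<in> J r c" "z \<in> a" "z \<in> b" for a b r c z
    using that t_pos[of r] by (auto simp: J_def)
  have finV: "finite (V ` Pi\<^sub>E C (J r))" for r
    using \<open>finite C\<close> by (intro finite_imageI finite_PiE) (auto simp: J_def)
  then have fin: "finite \<beta>" by (simp add: \<beta>_def)
  have cover: "x \<in> \<Union>\<beta>" if "x \<in> K" for x
  proof -
    let ?N = "{c\<in>C. \<bar>F c x - \<xi> c\<bar> \<le> \<eta>}"
    have "\<not> t ` {..m} \<subseteq> (\<lambda>c. \<bar>F c x - \<xi> c\<bar>) ` ?N"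
    proof
      assume "t ` {..m} \<subseteq> (\<lambda>c. \<bar>F c x - \<xi> c\<bar>) ` ?N"
      then have "card (t ` {..m}) \<le> card ?N"
        using \<open>finite C\<close> by (intro surj_card_le) auto
      then show False using near[OF that] card_image[OF t_inj] by simp
    qed
    then obtain r where "r \<le> m" and "t r \<notin> (\<lambda>c. \<bar>F c x - \<xi> c\<bar>) ` ?N" by auto
    have r: "\<bar>F c x - \<xi> c\<bar> \<noteq> t r" if "c \<in> C" for c
    proof
      assume "\<bar>F c x - \<xi> c\<bar> = t r"
      then have "c \<in> ?N" using that t_le[OF \<open>r \<le> m\<close>] by simp
      then show False
        using \<open>t r \<notin> _\<close> \<open>\<bar>F c x - \<xi> c\<bar> = t r\<close> by (metis (lifting) image_eqI)
    qed
    have "\<exists>I\<in>J r c. F c x \<in> I" if "c \<in> C" for c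
      using r[OF that] t_pos[of r] by (auto simp: J_def abs_if split: if_splits)
    then obtain s where s: "\<And>c. c \<in> C \<Longrightarrow> s c \<in> J r c \<and> F c x \<in> s c" by metis
    have "x \<in> V (restrict s C)" using s that by (auto simp: V_def)
    moreover have "restrict s C \<in> Pi\<^sub>E C (J r)" using s by auto
    ultimately show ?thesis unfolding \<beta>_def using \<open>r \<le> m\<close> by blast
  qed
  have opn: "openin (top_of_set K) (V s)" if "s \<in> Pi\<^sub>E C (J r)" for r s
  proof -
    have "openin (top_of_set K) (K \<inter> F c -` s c)" if "c \<in> C" for c
    proof -
      have "s c \<in> J r c" using \<open>s \<in> Pi\<^sub>E C (J r)\<close> that by auto
      moreover have "open I" if "I \<in> J r c" for I using that by (auto simp: J_def)
      ultimately have "open (s c)" by blast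
      then show ?thesis by (rule continuous_openin_preimage_gen[OF cont[OF that]])
    qed
    then have "openin (top_of_set K) ((\<Inter>c\<in>C. K \<inter> F c -` s c) \<inter> topspace (top_of_set K))"
      by (rule openin_INT[OF \<open>finite C\<close>])
    moreover have "(\<Inter>c\<in>C. K \<inter> F c -` s c) \<inter> topspace (top_of_set K) = V s"
      by (auto simp: V_def)
    ultimately show ?thesis by simp
  qed
  have "finite_open_cover K \<beta>"
    unfolding finite_open_cover_def
  proof (intro conjI ballI)
    show "finite \<beta>" by (fact fin)
    show "openin (top_of_set K) U" if "U \<in> \<beta>" for U
      using that opn unfolding \<beta>_def by blast
    have "\<Union>\<beta> \<subseteq> K" by (auto simp: \<beta>_def V_def)
    then show "\<Union>\<beta> = K" using cover by blast
  qed
  moreover have "\<beta> refines \<gamma>"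
    unfolding refines_def
  proof
    fix U assume "U \<in> \<beta>"
    then obtain r s where r: "r \<le> m" and s: "s \<in> Pi\<^sub>E C (J r)" and U: "U = V s"
      by (auto simp: \<beta>_def)
    show "\<exists>W\<in>\<gamma>. U \<subseteq> W"
    proof (rule refine)
      show "U \<subseteq> K" by (auto simp: U V_def)
      fix c assume "c \<in> C"
      then have "s c \<in> J r c" "\<forall>x\<in>U. F c x \<in> s c" using s by (auto simp: U V_def)
      \<comment> \<open>The lowest of the three intervals lies below \<open>\<xi> c\<close>; the
        other two lie above \<open>\<xi> c - t r\<close>, which is at least
        \<open>\<xi> c - \<eta>\<close>.\<close>
      then show "(\<forall>x\<in>U. \<xi> c - \<eta> < F c x) \<or> (\<forall>x\<in>U. F c x < \<xi> c)"
        using t_pos[of r] t_le[OF r] \<open>0 < \<eta>\<close> by (fastforce simp: J_def)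
    qed
  qed
  moreover have "cover_ord K \<beta> \<le> m"
  proof (rule cover_ord_le[OF \<open>K \<noteq> {}\<close> fin])
    fix x assume "x \<in> K"
    \<comment> \<open>Cells of one radius are disjoint, so \<open>x\<close> lies in at most one of
      them per radius, hence in at most \<open>m + 1\<close> members of \<open>\<beta>\<close>; the
      order subtracts 1.\<close>
    let ?B = "\<lambda>r. {U \<in> V ` Pi\<^sub>E C (J r). x \<in> U}"
    have "card (?B r) \<le> 1" for r
    proof -
      have "s = s'" if "s \<in> Pi\<^sub>E C (J r)" "s' \<in> Pi\<^sub>E C (J r)" "x \<in> V s" "x \<in> V s'" for s s'
      proof (rule PiE_ext[OF that(1,2)])
        fix c assume "c \<in> C"
        then show "s c = s' c"
          using that by (intro J_disj[of _ r c _ "F c x"]) (auto simp: V_def)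
      qed
      then have "\<forall>U\<in>?B r. \<forall>W\<in>?B r. U = W" by blast
      moreover have "finite (?B r)"
        by (rule finite_subset[OF _ finV[of r]]) auto
      ultimately show ?thesis by (simp add: card_le_Suc0_iff_eq)
    qed
    then have "(\<Sum>r\<le>m. card (?B r)) \<le> (\<Sum>r\<le>m. 1)" by (rule sum_mono)
    moreover have "card (\<Union>r\<le>m. ?B r) \<le> (\<Sum>r\<le>m. card (?B r))"
      by (rule card_UN_le) simp
    moreover have "{U \<in> \<beta>. x \<in> U} = (\<Union>r\<le>m. ?B r)" by (auto simp: \<beta>_def)
    ultimately show "card {U \<in> \<beta>. x \<in> U} \<le> Suc m" by simp
  qed
  ultimately show ?thesis
    unfolding cover_dim_def by (intro order.trans[OF cINF_lower]) auto
qed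

section \<open>Choice of levels by counting\<close>

text \<open>Union bound over the pairs of a \<open>y\<close> and a set \<open>S\<close> of
  \<open>m + 1\<close> coordinates. There are at most \<open>2 ^ card C * card Y\<close> pairs, and
  prescribing the values on \<open>S\<close> leaves a fraction \<open>1 / Q ^ Suc m\<close> of all
  vectors, so some vector avoids every pair.\<close>

lemma ex_few_agreements:
  fixes g :: "'y \<Rightarrow> 'c \<Rightarrow> nat"
  assumes "finite C" and "finite Y" and less: "2 ^ card C * card Y < Q ^ Suc m"
  shows "\<exists>q \<in> C \<rightarrow>\<^sub>E {..<Q}. \<forall>y\<in>Y. card {c\<in>C. q c = g y c} \<le> m"
proof -
  have "0 < Q ^ Suc m" using less by linarith
  then have "0 < Q" by simp
  define \<S> where "\<S> = {S. S \<subseteq> C \<and> card S = Suc m}"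
  \<comment> \<open>\<open>g y c\<close> may be \<open>Q\<close> or more, so these sets need not
    consist of vectors with values below \<open>Q\<close>; their cardinality is the same in any
    case.\<close>
  define B where
    "B = (\<lambda>(y, S). Pi\<^sub>E C (\<lambda>c. if c \<in> S then {g y c} else {..<Q}))"
  have fin\<S>: "finite \<S>" using \<open>finite C\<close> by (auto simp: \<S>_def)
  have "card \<S> \<le> 2 ^ card C"
    using card_mono[of "Pow C" \<S>] \<open>finite C\<close> by (auto simp: \<S>_def card_Pow)
  then have card_pairs: "card (Y \<times> \<S>) \<le> 2 ^ card C * card Y"
    by (simp add: card_cartesian_product)
  \<comment> \<open>The count is stated as a product, so that no subtraction in an exponent
    remains.\<close>
  have card_B: "Q ^ Suc m * card (B p) = Q ^ card C" if "p \<in> Y \<times> \<S>" for p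
  proof -
    obtain y S where p: "p = (y, S)" by fastforce
    then have S: "S \<subseteq> C" "card S = Suc m" using that by (auto simp: \<S>_def)
    have "card (B p) = (\<Prod>c\<in>C. card (if c \<in> S then {g y c} else {..<Q}))"
      using \<open>finite C\<close> by (simp add: p B_def card_PiE)
    also have "\<dots> = (\<Prod>c\<in>C - S. Q)"
      using \<open>finite C\<close> by (intro prod.mono_neutral_cong_right) auto
    also have "\<dots> = Q ^ (card C - Suc m)"
      using S \<open>finite C\<close> by (simp add: card_Diff_subset finite_subset)
    finally have "Q ^ Suc m * card (B p) = Q ^ (Suc m + (card C - Suc m))"
      by (simp only: power_add)
    then show ?thesis using card_mono[OF \<open>finite C\<close> S(1)] S(2) by simp
  qed
  have "Q ^ Suc m * card (\<Union>p\<in>Y \<times> \<S>. B p) \<le> Q ^ Suc m * (\<Sum>p\<in>Y \<times> \<S>. card (B p))"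
    using \<open>finite Y\<close> fin\<S> by (intro mult_left_mono card_UN_le) auto
  also have "\<dots> = card (Y \<times> \<S>) * Q ^ card C"
    by (simp only: sum_distrib_left card_B cong: sum.cong) simp
  also have "\<dots> < Q ^ Suc m * Q ^ card C"
    using card_pairs less \<open>0 < Q\<close> by (intro mult_strict_right_mono) auto
  finally have "card (\<Union>p\<in>Y \<times> \<S>. B p) < card (C \<rightarrow>\<^sub>E {..<Q})"
    using \<open>finite C\<close> by (simp add: card_PiE)
  moreover have "finite (\<Union>p\<in>Y \<times> \<S>. B p)"
    using \<open>finite Y\<close> \<open>finite C\<close> fin\<S> by (auto simp: B_def intro!: finite_PiE)
  ultimately have "\<not> (C \<rightarrow>\<^sub>E {..<Q}) \<subseteq> (\<Union>p\<in>Y \<times> \<S>. B p)"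
    using card_mono leD by blast
  then obtain q where q: "q \<in> C \<rightarrow>\<^sub>E {..<Q}" "\<And>p. p \<in> Y \<times> \<S> \<Longrightarrow> q \<notin> B p" by blast
  show ?thesis
  proof (intro bexI[OF _ q(1)] ballI, rule ccontr)
    fix y assume y: "y \<in> Y" and "\<not> card {c\<in>C. q c = g y c} \<le> m"
    then have "Suc m \<le> card {c\<in>C. q c = g y c}" by simp
    then obtain S where S: "S \<subseteq> {c\<in>C. q c = g y c}" "card S = Suc m"
      using obtain_subset_with_card_n by metis
    have "S \<subseteq> C" using S(1) by blast
    then have "(y, S) \<in> Y \<times> \<S>" using y S(2) by (simp add: \<S>_def)
    moreover have "q \<in> B (y, S)" 
      unfolding B_def prod.case
    proof (rule PiE_I)
      fix c assume "c \<in> C"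
      then show "q c \<in> (if c \<in> S then {g y c} else {..<Q})"
        using PiE_mem[OF q(1)] S(1) by (simp add: subset_iff)
    qed (rule PiE_arb[OF q(1)])
    ultimately show False using q(2) by blast
  qed
qed

section \<open>Separated sets and their growth rate\<close>

text \<open>\<open>Lim\<close> has a known value only once convergence is established. Monotonicity
  supplies it for the limit over scales in the entropy and gives the value as a supremum.\<close>

lemma antimono_tendsto_SUP_at_right:
  fixes f :: "real \<Rightarrow> ennreal"
  assumes "\<And>x y. 0 < x \<Longrightarrow> x \<le> y \<Longrightarrow> f y \<le> f x"
  shows "(f \<longlongrightarrow> (SUP x\<in>{0<..}. f x)) (at_right 0)"
proof (rule order_tendstoI)
  fix a assume "a < (SUP x\<in>{0<..}. f x)"
  then obtain x where "0 < x" "a < f x" by (auto simp: less_SUP_iff)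
  then show "\<forall>\<^sub>F y in at_right 0. a < f y"
    using assms by (auto simp: eventually_at_right_field intro!: exI[of _ x])
      (meson less_imp_le less_le_trans)
next
  fix a assume a: "(SUP x\<in>{0<..}. f x) < a"
  have "\<forall>\<^sub>F y in at_right 0. (0::real) < y" by (rule eventually_at_right_less)
  then show "\<forall>\<^sub>F y in at_right 0. f y < a"
  proof eventually_elim
    case (elim y)
    then have "f y \<le> (SUP x\<in>{0<..}. f x)" by (intro SUP_upper) simp
    then show ?case using a by (rule le_less_trans)
  qed
qed

lemma tendsto_0_le_ennreal:
  fixes f g :: "'i \<Rightarrow> ennreal"
  assumes "(g \<longlongrightarrow> 0) F" and "\<And>i. f i \<le> g i"
  shows "(f \<longlongrightarrow> 0) F"
  by (rule tendsto_sandwich[OF _ _ tendsto_const assms(1)]) (simp_all add: assms(2))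

lemma bowen_dist_ge_1_iff:
  assumes "0 < \<epsilon>" and "0 < n"
  shows "1 \<le> bowen_dist \<theta> T \<omega> \<epsilon> n x y
    \<longleftrightarrow> (\<exists>k<n. \<epsilon> \<le> dist (rds_iter \<theta> T k \<omega> x) (rds_iter \<theta> T k \<omega> y))"
  unfolding bowen_dist_def using assms by (subst Max_ge_iff) (auto simp: divide_simps)

definition separated ::
  "('w \<Rightarrow> 'w) \<Rightarrow> ('w \<times> 'x) set \<Rightarrow> ('w \<Rightarrow> 'x \<Rightarrow> 'x::metric_space) \<Rightarrow> 'w \<Rightarrow> real \<Rightarrow> nat \<Rightarrow> 'x set \<Rightarrow> bool"
  where "separated \<theta> \<E> T \<omega> \<epsilon> n F \<longleftrightarrow> finite F \<and> F \<subseteq> fiber \<E> \<omega> \<and>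
    (\<forall>x\<in>F. \<forall>y\<in>F. x \<noteq> y \<longrightarrow> bowen_dist \<theta> T \<omega> \<epsilon> n x y \<ge> 1)"

lemma sep_number_eq: "sep_number \<theta> \<E> T \<omega> \<epsilon> n = (SUP F\<in>{F. separated \<theta> \<E> T \<omega> \<epsilon> n F}. card F)"
  by (simp add: sep_number_def separated_def)

text \<open>No continuity is needed here: the itineraries through a finite \<open>\<epsilon>/2\<close>-net of the whole space
  separate the points.\<close>

lemma card_separated_bounded:
  fixes T :: "'w \<Rightarrow> 'x \<Rightarrow> 'x::metric_space"
  assumes "compact (UNIV :: 'x set)" and "0 < \<epsilon>" and "0 < n"
  shows "\<exists>N. \<forall>F. separated \<theta> \<E> T \<omega> \<epsilon> n F \<longrightarrow> card F \<le> N"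
proof -
  have "UNIV \<subseteq> (\<Union>z\<in>(UNIV :: 'x set). ball z (\<epsilon> / 2))"
    using \<open>0 < \<epsilon>\<close> by (auto intro!: exI[of _ "x" for x])
  then obtain Z :: "'x set" where Z: "finite Z" "UNIV \<subseteq> (\<Union>z\<in>Z. ball z (\<epsilon> / 2))"
    by (rule compactE_image[OF assms(1), rotated]) auto
  then have "\<forall>x. \<exists>z\<in>Z. dist z x < \<epsilon> / 2" by (auto simp: subset_iff)
  then obtain p where p: "\<And>x. p x \<in> Z" "\<And>x. dist (p x) x < \<epsilon> / 2" by metis
  define I where "I x = (\<lambda>k\<in>{..<n}. p (rds_iter \<theta> T k \<omega> x))" for x
  have "card F \<le> card ({..<n} \<rightarrow>\<^sub>E Z)" if F: "separated \<theta> \<E> T \<omega> \<epsilon> n F" for F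
  proof (rule card_inj_on_le)
    show "inj_on I F"
    proof (rule inj_onI, rule ccontr)
      fix x y assume xy: "x \<in> F" "y \<in> F" "I x = I y" "x \<noteq> y"
      then have "1 \<le> bowen_dist \<theta> T \<omega> \<epsilon> n x y" using F by (simp add: separated_def)
      then obtain k where k: "k < n" "\<epsilon> \<le> dist (rds_iter \<theta> T k \<omega> x) (rds_iter \<theta> T k \<omega> y)"
        unfolding bowen_dist_ge_1_iff[OF \<open>0 < \<epsilon>\<close> \<open>0 < n\<close>] by blast
      have "p (rds_iter \<theta> T k \<omega> x) = p (rds_iter \<theta> T k \<omega> y)"
        using fun_cong[OF xy(3), of k] k(1) by (simp add: I_def)
      then show False
        using k(2) p(2)[of "rds_iter \<theta> T k \<omega> x"] p(2)[of "rds_iter \<theta> T k \<omega> y"]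
        by (smt (verit) dist_commute dist_triangle field_sum_of_halves)
    qed
    show "I ` F \<subseteq> {..<n} \<rightarrow>\<^sub>E Z" by (simp add: image_subset_iff I_def restrict_PiE_iff p(1))
    show "finite ({..<n} \<rightarrow>\<^sub>E Z)" using Z(1) by (intro finite_PiE) auto
  qed
  then show ?thesis by blast
qed

text \<open>A supremum of naturals is known to be an upper bound only for a bounded family;
  \<open>card_separated_bounded\<close> provides the bound.\<close>

lemma card_le_sep_number:
  fixes T :: "'w \<Rightarrow> 'x \<Rightarrow> 'x::metric_space"
  assumes "compact (UNIV :: 'x set)" and "0 < \<epsilon>" and "0 < n" and "separated \<theta> \<E> T \<omega> \<epsilon> n F"
  shows "card F \<le> sep_number \<theta> \<E> T \<omega> \<epsilon> n"
  unfolding sep_number_eq using assms card_separated_bounded[OF assms(1-3), of \<theta> \<E> T \<omega>]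
  by (intro cSUP_upper) (auto simp: bdd_above_def)

lemma sep_number_antimono:
  fixes T :: "'w \<Rightarrow> 'x \<Rightarrow> 'x::metric_space"
  assumes "compact (UNIV :: 'x set)" and "0 < \<delta>" and "\<delta> \<le> \<epsilon>" and "0 < n"
  shows "sep_number \<theta> \<E> T \<omega> \<epsilon> n \<le> sep_number \<theta> \<E> T \<omega> \<delta> n"
  unfolding sep_number_eq[of _ _ _ _ \<epsilon>]
proof (rule cSUP_least)
  show "{F. separated \<theta> \<E> T \<omega> \<epsilon> n F} \<noteq> {}" by (auto simp: separated_def intro!: exI[of _ "{}"])
  fix F assume "F \<in> {F. separated \<theta> \<E> T \<omega> \<epsilon> n F}"
  moreover have "1 \<le> bowen_dist \<theta> T \<omega> \<delta> n x y" if "1 \<le> bowen_dist \<theta> T \<omega> \<epsilon> n x y" for x y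
    using that assms by (auto simp: bowen_dist_ge_1_iff intro: order.trans)
  ultimately have "separated \<theta> \<E> T \<omega> \<delta> n F" by (auto simp: separated_def)
  then show "card F \<le> sep_number \<theta> \<E> T \<omega> \<delta> n" using assms by (intro card_le_sep_number)
qed

text \<open>Shrinking the scale increases the growth rate, so the limit at 0 is a supremum over
  scales. This gives a bound uniform in \<open>\<epsilon>\<close>, which later allows the scale to
  be chosen last.\<close>

lemma sep_growth_le_Lim:
  fixes T :: "'w \<Rightarrow> 'x \<Rightarrow> 'x::metric_space"
  assumes "compact (UNIV :: 'x set)" and "0 < \<epsilon>" and "fiber \<E> \<omega> \<noteq> {}"
  shows "sep_growth \<theta> \<E> T \<omega> \<epsilon> \<le> Lim (at_right 0) (sep_growth \<theta> \<E> T \<omega>)"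
proof -
  \<comment> \<open>A singleton is separated, so the logarithms are taken of positive numbers, where
    \<open>ln\<close> is monotone.\<close>
  have pos: "0 < sep_number \<theta> \<E> T \<omega> \<delta> n" if "0 < \<delta>" "0 < n" for \<delta> n
  proof -
    obtain x where "x \<in> fiber \<E> \<omega>" using assms(3) by blast
    then have "separated \<theta> \<E> T \<omega> \<delta> n {x}" by (auto simp: separated_def)
    from card_le_sep_number[OF assms(1) that this] show ?thesis by simp
  qed
  have "sep_growth \<theta> \<E> T \<omega> y \<le> sep_growth \<theta> \<E> T \<omega> x" if "0 < x" "x \<le> y" for x y
    unfolding sep_growth_def
  proof (intro Limsup_mono)
    have "\<forall>\<^sub>F n in sequentially. (0::nat) < n" by (rule eventually_gt_at_top)
    then show "\<forall>\<^sub>F n in sequentially.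
      ennreal (ln (real (sep_number \<theta> \<E> T \<omega> y n)) / real n)
      \<le> ennreal (ln (real (sep_number \<theta> \<E> T \<omega> x n)) / real n)"
    proof eventually_elim
      case (elim n)
      have "0 < sep_number \<theta> \<E> T \<omega> y n" using that elim by (intro pos) auto
      then show ?case
        using sep_number_antimono[OF assms(1) that elim, of \<theta> \<E> T \<omega>]
        by (intro ennreal_leI divide_right_mono) auto
    qed
  qed
  then have "Lim (at_right 0) (sep_growth \<theta> \<E> T \<omega>) = (SUP x\<in>{0<..}. sep_growth \<theta> \<E> T \<omega> x)"
    by (intro tendsto_Lim antimono_tendsto_SUP_at_right) auto
  then show ?thesis using assms(2) by (auto intro: SUP_upper)
qed

text \<open>A separated set of maximal cardinality is spanning: a point far from all its members
  could be added to it.\<close>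

lemma ex_spanning_set:
  fixes T :: "'w \<Rightarrow> 'x \<Rightarrow> 'x::metric_space"
  assumes "compact (UNIV :: 'x set)" and "0 < \<epsilon>" and "0 < n"
  shows "\<exists>Y. finite Y \<and> card Y \<le> sep_number \<theta> \<E> T \<omega> \<epsilon> n \<and> (\<forall>x\<in>fiber \<E> \<omega>.
    \<exists>y\<in>Y. \<forall>k<n. dist (rds_iter \<theta> T k \<omega> x) (rds_iter \<theta> T k \<omega> y) < \<epsilon>)"
proof -
  obtain N where "\<And>F. separated \<theta> \<E> T \<omega> \<epsilon> n F \<Longrightarrow> card F \<le> N"
    using card_separated_bounded[OF assms, of \<theta> \<E> T \<omega>] by blast
  moreover have "separated \<theta> \<E> T \<omega> \<epsilon> n {}" by (simp add: separated_def)
  ultimately obtain Y where Y: "separated \<theta> \<E> T \<omega> \<epsilon> n Y"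
      "\<And>F. separated \<theta> \<E> T \<omega> \<epsilon> n F \<Longrightarrow> card F \<le> card Y"
    using Lattices_Big.ex_has_greatest_nat[of "separated \<theta> \<E> T \<omega> \<epsilon> n" "{}" card "Suc N"]
    by (meson less_Suc_eq_le)
  show ?thesis
  proof (intro exI conjI ballI)
    show "finite Y" using Y(1) by (simp add: separated_def)
    show "card Y \<le> sep_number \<theta> \<E> T \<omega> \<epsilon> n" using Y(1) by (intro card_le_sep_number assms)
    fix x assume x: "x \<in> fiber \<E> \<omega>"
    show "\<exists>y\<in>Y. \<forall>k<n. dist (rds_iter \<theta> T k \<omega> x) (rds_iter \<theta> T k \<omega> y) < \<epsilon>"
    proof (rule ccontr)
      assume "\<not> ?thesis"
      then have far: "\<exists>k<n. \<epsilon> \<le> dist (rds_iter \<theta> T k \<omega> x) (rds_iter \<theta> T k \<omega> y)" if "y \<in> Y" for y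
        using that by (meson not_less)
      then have "x \<notin> Y" using \<open>0 < \<epsilon>\<close> by fastforce
      moreover have "separated \<theta> \<E> T \<omega> \<epsilon> n (insert x Y)"
        using Y(1) x far assms(2,3) unfolding separated_def
        by (auto simp: bowen_dist_ge_1_iff dist_commute)
      ultimately show False using Y(2)[of "insert x Y"] \<open>finite Y\<close> by simp
    qed
  qed
qed

section \<open>Iterates on the fibers\<close>

lemma rds_iter_fiber:
  assumes "\<And>i. T ((\<theta> ^^ i) \<omega>) \<in> fiber \<E> ((\<theta> ^^ i) \<omega>) \<rightarrow> fiber \<E> ((\<theta> ^^ Suc i) \<omega>)"
  shows "rds_iter \<theta> T i \<omega> \<in> fiber \<E> \<omega> \<rightarrow> fiber \<E> ((\<theta> ^^ i) \<omega>)"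
proof (induction i)
  case (Suc i)
  then show ?case using assms[of i] by (auto simp: Pi_iff)
qed simp

lemma rds_iter_continuous_on:
  fixes T :: "'w \<Rightarrow> 'x \<Rightarrow> 'x::metric_space"
  assumes "\<And>i. T ((\<theta> ^^ i) \<omega>) \<in> fiber \<E> ((\<theta> ^^ i) \<omega>) \<rightarrow> fiber \<E> ((\<theta> ^^ Suc i) \<omega>)"
    and "\<And>i. continuous_on (fiber \<E> ((\<theta> ^^ i) \<omega>)) (T ((\<theta> ^^ i) \<omega>))"
  shows "continuous_on (fiber \<E> \<omega>) (rds_iter \<theta> T i \<omega>)"
proof (induction i)
  case (Suc i)
  have "continuous_on (fiber \<E> \<omega>) (T ((\<theta> ^^ i) \<omega>) \<circ> rds_iter \<theta> T i \<omega>)"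
    using rds_iter_fiber[OF assms(1), of i]
    by (intro continuous_on_compose Suc continuous_on_subset[OF assms(2)[of i]]) auto
  then show ?case by simp
qed (simp add: continuous_on_id')

section \<open>Averages of possibly nonmeasurable functions\<close>

text \<open>The functions need not be measurable: the integral of a nonmeasurable function is
  approximated by simple functions below it, and finiteness of \<open>\<integral>\<^sup>+ h\<close> says that \<open>{h = \<infinity>}\<close> has inner
  measure zero.\<close>

lemma (in prob_space) nn_integral_averages_tendsto_0:
  fixes u :: "nat \<Rightarrow> 'a \<Rightarrow> ennreal" and h :: "'a \<Rightarrow> ennreal"
  assumes bound: "AE \<omega> in M. \<forall>n. u n \<omega> \<le> of_nat (k * n)"
    and lim0: "AE \<omega> in M. h \<omega> < \<infinity> \<longrightarrow> (\<lambda>n. u n \<omega> / of_nat n) \<longlonglongrightarrow> 0"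
    and fin: "(\<integral>\<^sup>+\<omega>. h \<omega> \<partial>M) < \<infinity>"
  shows "(\<lambda>n. (\<integral>\<^sup>+\<omega>. u n \<omega> \<partial>M) / of_nat n) \<longlonglongrightarrow> 0"
proof -
  have u_fin: "(\<integral>\<^sup>+\<omega>. u n \<omega> \<partial>M) \<le> of_nat (k * n)" for n
  proof -
    have "(\<integral>\<^sup>+\<omega>. u n \<omega> \<partial>M) \<le> (\<integral>\<^sup>+\<omega>. of_nat (k * n) \<partial>M)"
      using bound by (intro nn_integral_mono_AE) auto
    then show ?thesis by (simp add: emeasure_space_1)
  qed
  \<comment> \<open>An error of 1 suffices, as it is divided by \<open>n\<close> in the end. The
    value 0 is treated apart because truncated subtraction gives no number strictly below
    it.\<close>
  have "\<exists>g. simple_function M g \<and> g \<le> u n \<and> (\<integral>\<^sup>+\<omega>. u n \<omega> \<partial>M) \<le> (\<integral>\<^sup>+\<omega>. g \<omega> \<partial>M) + 1" for n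
  proof (cases "(\<integral>\<^sup>+\<omega>. u n \<omega> \<partial>M) = 0")
    case True
    then show ?thesis by (intro exI[of _ "\<lambda>_. 0"]) (auto simp: le_fun_def)
  next
    case False
    have "(\<integral>\<^sup>+\<omega>. u n \<omega> \<partial>M) < \<top>"
      using u_fin[of n] by (meson ennreal_of_nat_neq_top le_less_trans top.not_eq_extremum)
    then have "(\<integral>\<^sup>+\<omega>. u n \<omega> \<partial>M) - 1 < (\<integral>\<^sup>+\<omega>. u n \<omega> \<partial>M)"
      using False by (intro ennreal_between) (auto simp: zero_less_iff_neq_zero)
    then obtain g where g: "simple_function M g" "g \<le> u n"
        "(\<integral>\<^sup>+\<omega>. u n \<omega> \<partial>M) - 1 < integral\<^sup>S M g"
      unfolding nn_integral_def[of M "u n"] less_SUP_iff by blast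
    have "(\<integral>\<^sup>+\<omega>. u n \<omega> \<partial>M) \<le> 1 + (\<integral>\<^sup>+\<omega>. g \<omega> \<partial>M)"
      using less_imp_le[OF g(3)] unfolding nn_integral_eq_simple_integral[OF g(1)]
      by (simp add: ennreal_minus_le_iff)
    then have "(\<integral>\<^sup>+\<omega>. u n \<omega> \<partial>M) \<le> (\<integral>\<^sup>+\<omega>. g \<omega> \<partial>M) + 1"
      by (simp only: add.commute)
    then show ?thesis using g by blast
  qed
  then obtain g where g: "\<And>n. simple_function M (g n)" "\<And>n. g n \<le> u n"
      "\<And>n. (\<integral>\<^sup>+\<omega>. u n \<omega> \<partial>M) \<le> (\<integral>\<^sup>+\<omega>. g n \<omega> \<partial>M) + 1"
    by metis
  \<comment> \<open>Shifting the index avoids division by 0 at the first term.\<close>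
  define v where "v n \<omega> = g (Suc n) \<omega> / of_nat (Suc n)" for n \<omega>
  have [measurable]: "g n \<in> borel_measurable M" for n
    using g(1) by (rule borel_measurable_simple_function)
  have v_meas [measurable]: "v n \<in> borel_measurable M" for n
    unfolding v_def by measurable
  define L where "L \<omega> = limsup (\<lambda>n. v n \<omega>)" for \<omega>
  have [measurable]: "L \<in> borel_measurable M" unfolding L_def by measurable
  have L0: "AE \<omega> in M. h \<omega> < \<infinity> \<longrightarrow> L \<omega> = 0"
    using lim0
  proof eventually_elim
    case (elim \<omega>)
    show ?case
    proof
      assume "h \<omega> < \<infinity>"
      then have "(\<lambda>n. u (Suc n) \<omega> / of_nat (Suc n)) \<longlonglongrightarrow> 0"
        using elim by (subst filterlim_sequentially_Suc) auto
      moreover have "v n \<omega> \<le> u (Suc n) \<omega> / of_nat (Suc n)" for n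
        using g(2)[of "Suc n"] unfolding v_def
        by (intro divide_right_mono_ennreal) (auto simp: le_fun_def)
      ultimately have "(\<lambda>n. v n \<omega>) \<longlonglongrightarrow> 0"
        by (rule tendsto_0_le_ennreal)
      then show "L \<omega> = 0" unfolding L_def by (intro lim_imp_Limsup) auto
    qed
  qed
  have "AE \<omega> in M. L \<omega> = 0"
  proof -
    \<comment> \<open>\<open>L\<close> is measurable, hence so is this set. Almost everywhere on it
      \<open>h\<close> is infinite, so a finite integral of \<open>h\<close> forces it to be
      null.\<close>
    let ?B = "{\<omega>\<in>space M. L \<omega> \<noteq> 0}"
    have B: "?B \<in> sets M" by measurable
    have "(\<integral>\<^sup>+\<omega>. \<infinity> * indicator ?B \<omega> \<partial>M) \<le> (\<integral>\<^sup>+\<omega>. h \<omega> \<partial>M)"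
    proof (rule nn_integral_mono_AE)
      show "AE \<omega> in M. \<infinity> * indicator ?B \<omega> \<le> h \<omega>"
        using L0 by eventually_elim (auto simp: indicator_def top.not_eq_extremum)
    qed
    then have "\<infinity> * emeasure M ?B < \<infinity>"
      using fin B by (simp add: nn_integral_cmult_indicator)
    then have "emeasure M ?B = 0" by (cases "emeasure M ?B = 0") (auto simp: ennreal_top_mult)
    then show ?thesis using AE_iff_measurable[OF B, of "\<lambda>\<omega>. L \<omega> = 0"] by simp
  qed
  then have int_L: "(\<integral>\<^sup>+\<omega>. L \<omega> \<partial>M) = 0" by (simp add: nn_integral_0_iff_AE)
  \<comment> \<open>Reverse Fatou lemma, with the constant \<open>k\<close> as dominating
    function.\<close>
  have "limsup (\<lambda>n. \<integral>\<^sup>+\<omega>. v n \<omega> \<partial>M) \<le> (\<integral>\<^sup>+\<omega>. L \<omega> \<partial>M)"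
    unfolding L_def
  proof (rule nn_integral_limsup[where w = "\<lambda>_. of_nat k"])
    fix n
    show "AE \<omega> in M. v n \<omega> \<le> of_nat k"
      using bound
    proof eventually_elim
      case (elim \<omega>)
      have "g (Suc n) \<omega> \<le> of_nat (k * Suc n)"
        using elim g(2)[of "Suc n"] by (meson le_fun_def order.trans)
      then have "g (Suc n) \<omega> \<le> of_nat (Suc n) * of_nat k"
        by (simp only: of_nat_mult mult.commute)
      then show ?case unfolding v_def
        by (intro divide_le_posI_ennreal) (simp_all del: of_nat_Suc add: mult.commute)
    qed
  qed (auto simp: emeasure_space_1 of_nat_less_top)
  then have "(\<lambda>n. \<integral>\<^sup>+\<omega>. v n \<omega> \<partial>M) \<longlonglongrightarrow> 0"
    unfolding int_L using Liminf_le_Limsup[of sequentially "\<lambda>n. \<integral>\<^sup>+\<omega>. v n \<omega> \<partial>M"]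
    by (intro Liminf_eq_Limsup) auto
  moreover have "(\<lambda>n. 1 / of_nat (Suc n) :: ennreal) \<longlonglongrightarrow> 0"
  proof -
    have "(\<lambda>n. ennreal (1 / real (Suc n))) \<longlonglongrightarrow> ennreal 0"
      by (intro tendsto_ennrealI LIMSEQ_Suc lim_1_over_n)
    moreover have "ennreal (1 / real (Suc n)) = 1 / of_nat (Suc n)" for n
      by (subst divide_ennreal[symmetric]) (auto simp: ennreal_of_nat_eq_real_of_nat)
    ultimately show ?thesis by simp
  qed
  ultimately have "(\<lambda>n. (\<integral>\<^sup>+\<omega>. v n \<omega> \<partial>M) + 1 / of_nat (Suc n)) \<longlonglongrightarrow> 0 + 0"
    by (intro tendsto_add)
  then have "(\<lambda>n. (\<integral>\<^sup>+\<omega>. v n \<omega> \<partial>M) + 1 / of_nat (Suc n)) \<longlonglongrightarrow> 0"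
    by (simp only: add_0)
  moreover have "(\<integral>\<^sup>+\<omega>. u (Suc n) \<omega> \<partial>M) / of_nat (Suc n)
      \<le> (\<integral>\<^sup>+\<omega>. v n \<omega> \<partial>M) + 1 / of_nat (Suc n)" for n
  proof -
    have "(\<integral>\<^sup>+\<omega>. u (Suc n) \<omega> \<partial>M) / of_nat (Suc n)
        \<le> ((\<integral>\<^sup>+\<omega>. g (Suc n) \<omega> \<partial>M) + 1) / of_nat (Suc n)"
      by (intro divide_right_mono_ennreal g(3))
    also have "\<dots> = (\<integral>\<^sup>+\<omega>. v n \<omega> \<partial>M) + 1 / of_nat (Suc n)"
      unfolding v_def by (subst nn_integral_divide) (auto simp: add_divide_distrib_ennreal)
    finally show ?thesis .
  qed
  ultimately have "(\<lambda>n. (\<integral>\<^sup>+\<omega>. u (Suc n) \<omega> \<partial>M) / of_nat (Suc n)) \<longlonglongrightarrow> 0"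
    by (rule tendsto_0_le_ennreal)
  then show ?thesis by (subst (asm) filterlim_sequentially_Suc)
qed

section \<open>Dimension of iterated covers over a single base point\<close>

context continuous_bundle_rds
begin

text \<open>The condition concerns the whole forward orbit because every iterate enters the covers.
  Membership in \<open>space M\<close> gives access to the assumptions on the fibers and
  maps.\<close>

definition regular_point :: "'w \<Rightarrow> bool" where
  "regular_point \<omega> \<longleftrightarrow> (\<forall>i. (\<theta> ^^ i) \<omega> \<in> space M \<and>
     continuous_on (fiber \<E> ((\<theta> ^^ i) \<omega>)) (T ((\<theta> ^^ i) \<omega>)))"

text \<open>Invariance of the measure pulls the condition at time \<open>i\<close> back along
  \<open>\<theta>\<close> to time \<open>i + 1\<close>; then countably many almost sure events are
  intersected.\<close>

lemma AE_regular_point: "AE \<omega> in M. regular_point \<omega>"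
proof -
  have "AE \<omega> in M. (\<theta> ^^ i) \<omega> \<in> space M \<and>
      continuous_on (fiber \<E> ((\<theta> ^^ i) \<omega>)) (T ((\<theta> ^^ i) \<omega>))" for i
  proof (induction i)
    case 0
    show ?case using rds_continuous AE_space by eventually_elim simp
  next
    case (Suc i)
    have "AE \<omega> in distr M M \<theta>. (\<theta> ^^ i) \<omega> \<in> space M \<and>
        continuous_on (fiber \<E> ((\<theta> ^^ i) \<omega>)) (T ((\<theta> ^^ i) \<omega>))"
      unfolding base_preserving by (rule Suc)
    from AE_distrD[OF base_measurable this] show ?case
      by (simp add: funpow_swap1)
  qed
  then show ?thesis unfolding regular_point_def by (simp add: AE_all_countable)
qed

lemma regular_point_maps:
  assumes "regular_point \<omega>"
  shows "fiber \<E> \<omega> \<noteq> {}"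
    and "rds_iter \<theta> T i \<omega> \<in> fiber \<E> \<omega> \<rightarrow> fiber \<E> ((\<theta> ^^ i) \<omega>)"
    and "continuous_on (fiber \<E> \<omega>) (rds_iter \<theta> T i \<omega>)"
proof -
  have sp: "(\<theta> ^^ i) \<omega> \<in> space M" for i using assms by (auto simp: regular_point_def)
  show "fiber \<E> \<omega> \<noteq> {}" using fiber_nonempty[OF sp[of 0]] by simp
  have maps: "T ((\<theta> ^^ i) \<omega>) \<in> fiber \<E> ((\<theta> ^^ i) \<omega>) \<rightarrow> fiber \<E> ((\<theta> ^^ Suc i) \<omega>)" for i
    using maps_fiber[OF sp[of i]] by simp
  show "rds_iter \<theta> T i \<omega> \<in> fiber \<E> \<omega> \<rightarrow> fiber \<E> ((\<theta> ^^ i) \<omega>)"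
    by (rule rds_iter_fiber[OF maps])
  show "continuous_on (fiber \<E> \<omega>) (rds_iter \<theta> T i \<omega>)"
    using assms by (intro rds_iter_continuous_on[OF maps]) (auto simp: regular_point_def)
qed

text \<open>The functions cut are \<open>f A\<close> composed with the \<open>i\<close>-th iterate.
  For each \<open>i\<close>, some \<open>f A\<close> is at least \<open>\<rho>\<close>, hence not
  below its level, at one point of a cell. The cell then lies wholly on the upper side, where the
  function exceeds \<open>\<xi> (i, A) - \<eta> \<ge> 0\<close>, so its \<open>i\<close>-th image is
  inside \<open>A\<close>.\<close>

lemma cover_dim_iterated_cover_le:
  fixes f :: "'x set \<Rightarrow> 'x \<Rightarrow> real"
  assumes "regular_point \<omega>" and "finite \<alpha>" and "0 < \<eta>"
    and f: "lebesgue_family \<alpha> \<rho> f"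
    and \<xi>: "\<And>c. c \<in> {..<n} \<times> \<alpha> \<Longrightarrow> \<eta> \<le> \<xi> c \<and> \<xi> c \<le> \<rho>"
    and near: "\<And>x. x \<in> fiber \<E> \<omega> \<Longrightarrow>
      card {(i, A)\<in>{..<n} \<times> \<alpha>. \<bar>f A (rds_iter \<theta> T i \<omega> x) - \<xi> (i, A)\<bar> \<le> \<eta>} \<le> m"
  shows "cover_dim (fiber \<E> \<omega>) (iterated_cover \<theta> \<E> T \<alpha> n \<omega>) \<le> m"
proof (rule cover_dim_le_of_few_near_levels
    [where F = "\<lambda>(i, A) x. f A (rds_iter \<theta> T i \<omega> x)" and C = "{..<n} \<times> \<alpha>" and \<xi> = \<xi> and \<eta> = \<eta>])
  note maps = regular_point_maps[OF assms(1)]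
  show "finite ({..<n} \<times> \<alpha>)" using \<open>finite \<alpha>\<close> by simp
  show "fiber \<E> \<omega> \<noteq> {}" by (fact maps(1))
  show "0 < \<eta>" by fact
  have cont_f: "continuous_on UNIV (f A)" for A
  proof -
    have "1-lipschitz_on UNIV (f A)"
      using lebesgue_familyD(2)[OF f] by (intro lipschitz_onI) (auto simp: dist_real_def)
    then show ?thesis by (rule lipschitz_on_continuous_on)
  qed
  fix c assume "c \<in> {..<n} \<times> \<alpha>"
  show "continuous_on (fiber \<E> \<omega>) ((\<lambda>(i, A) x. f A (rds_iter \<theta> T i \<omega> x)) c)"
    using continuous_on_compose2[OF cont_f maps(3)] by (auto split: prod.splits)
next
  fix x assume "x \<in> fiber \<E> \<omega>"
  from near[OF this] show "card {c\<in>{..<n} \<times> \<alpha>.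
      \<bar>(\<lambda>(i, A) x. f A (rds_iter \<theta> T i \<omega> x)) c x - \<xi> c\<bar> \<le> \<eta>} \<le> m"
    by (simp only: case_prod_unfold prod.collapse)
next
  fix V
  assume V: "V \<subseteq> fiber \<E> \<omega>" and side: "\<And>c. c \<in> {..<n} \<times> \<alpha> \<Longrightarrow>
      (\<forall>x\<in>V. \<xi> c - \<eta> < (\<lambda>(i, A) x. f A (rds_iter \<theta> T i \<omega> x)) c x) \<or>
      (\<forall>x\<in>V. (\<lambda>(i, A) x. f A (rds_iter \<theta> T i \<omega> x)) c x < \<xi> c)"
  have "\<exists>A\<in>\<alpha>. \<forall>x\<in>V. rds_iter \<theta> T i \<omega> x \<in> A" if "i < n" for i
  proof (cases "V = {}")
    case True
    then show ?thesis using lebesgue_familyD(4)[OF f] by blast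
  next
    case False
    then obtain x where x: "x \<in> V" by blast
    obtain A where A: "A \<in> \<alpha>" "\<rho> \<le> f A (rds_iter \<theta> T i \<omega> x)" using lebesgue_familyD(4)[OF f] by blast
    have c: "(i, A) \<in> {..<n} \<times> \<alpha>" using that A by simp
    then have "\<forall>y\<in>V. 0 < f A (rds_iter \<theta> T i \<omega> y)"
      using side[OF c] \<xi>[OF c] A(2) x by fastforce
    then show ?thesis using A(1) lebesgue_familyD(3)[OF f] by blast
  qed
  then obtain A where A: "\<And>i. i < n \<Longrightarrow> A i \<in> \<alpha> \<and> (\<forall>x\<in>V. rds_iter \<theta> T i \<omega> x \<in> A i)" by metis
  show "\<exists>U\<in>iterated_cover \<theta> \<E> T \<alpha> n \<omega>. V \<subseteq> U"
  proof
    show "fiber \<E> \<omega> \<inter> (\<Inter>i<n. rds_iter \<theta> T i \<omega> -` (A i \<inter> fiber \<E> ((\<theta> ^^ i) \<omega>)))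
        \<in> iterated_cover \<theta> \<E> T \<alpha> n \<omega>"
      unfolding iterated_cover_def using A by blast
    show "V \<subseteq> fiber \<E> \<omega> \<inter> (\<Inter>i<n. rds_iter \<theta> T i \<omega> -` (A i \<inter> fiber \<E> ((\<theta> ^^ i) \<omega>)))"
      using A V regular_point_maps(2)[OF assms(1)] by fastforce
  qed
qed

text \<open>A bound uniform in the base point, for domination under the integral. All levels equal
  \<open>\<rho>\<close>, and near-coincidences are bounded by the number of all index pairs.\<close>

lemma cover_dim_iterated_cover_le_card:
  assumes "regular_point \<omega>" and "finite_open_cover UNIV \<alpha>"
  shows "cover_dim (fiber \<E> \<omega>) (iterated_cover \<theta> \<E> T \<alpha> n \<omega>) \<le> card \<alpha> * n"
proof -
  have fin: "finite \<alpha>" using assms(2) by (simp add: finite_open_cover_def)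
  obtain \<rho> f where f: "lebesgue_family \<alpha> \<rho> f"
    using ex_lebesgue_family[OF compact_space assms(2)] by blast
  have sub: "card {(i, A)\<in>{..<n} \<times> \<alpha>. \<bar>f A (rds_iter \<theta> T i \<omega> x) - \<rho>\<bar> \<le> \<rho>}
      \<le> card ({..<n} \<times> \<alpha>)" for x
    using fin by (intro card_mono) auto
  show ?thesis
  proof (rule cover_dim_iterated_cover_le
      [where f = f and \<eta> = \<rho> and \<rho> = \<rho> and \<xi> = "\<lambda>_. \<rho>", OF assms(1) fin lebesgue_familyD(1)[OF f] f])
    show "card {(i, A)\<in>{..<n} \<times> \<alpha>. \<bar>f A (rds_iter \<theta> T i \<omega> x) - \<rho>\<bar> \<le> \<rho>} \<le> card \<alpha> * n" for x
      using sub[of x] by (simp add: card_cartesian_product mult.commute)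
  qed auto
qed

text \<open>The levels are taken from the grid \<open>\<epsilon> + 4\<epsilon>q\<close>, \<open>q < Q\<close>. Each of the \<open>sep_number\<close> Bowen balls
  covering the fiber is near at most one grid point in each coordinate, so that a level vector
  with few near-coincidences is found by counting.\<close>

lemma cover_dim_le_of_sep_number_less:
  fixes f :: "'x set \<Rightarrow> 'x \<Rightarrow> real"
  assumes "regular_point \<omega>" and "finite \<alpha>" and "0 < n"
    and f: "lebesgue_family \<alpha> \<rho> f"
    and less: "2 ^ (card \<alpha> * n) * sep_number \<theta> \<E> T \<omega> (\<rho> / (4 * real Q + 1)) n < Q ^ Suc m"
  shows "cover_dim (fiber \<E> \<omega>) (iterated_cover \<theta> \<E> T \<alpha> n \<omega>) \<le> m"
proof -
  \<comment> \<open>With this scale \<open>\<rho>\<close> equals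
    \<open>\<epsilon> + 4 * \<epsilon> * Q\<close>, so all grid levels lie between
    \<open>\<epsilon>\<close> and \<open>\<rho>\<close>.\<close>
  define \<epsilon> where "\<epsilon> = \<rho> / (4 * real Q + 1)"
  have "0 < \<epsilon>" using lebesgue_familyD(1)[OF f] by (simp add: \<epsilon>_def add_nonneg_pos)
  have \<rho>: "\<rho> = 4 * \<epsilon> * real Q + \<epsilon>"
  proof -
    have "\<epsilon> * (4 * real Q + 1) = \<rho>" unfolding \<epsilon>_def by (simp add: add_nonneg_eq_0_iff)
    then show ?thesis by (simp add: algebra_simps)
  qed
  define F where "F = (\<lambda>(i, A) x. f A (rds_iter \<theta> T i \<omega> x))"
  define grid where "grid q = \<epsilon> + 4 * \<epsilon> * real q" for q :: nat
  define C where "C = {..<n} \<times> \<alpha>"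
  have "finite C" "card C = card \<alpha> * n"
    using \<open>finite \<alpha>\<close> by (simp_all add: C_def card_cartesian_product)
  \<comment> \<open>Neighbouring grid points are \<open>4 * \<epsilon>\<close> apart, so at most one
    is within \<open>2 * \<epsilon>\<close> of a given value.\<close>
  have grid_inj: "p = q" if "\<bar>grid p - z\<bar> < 2 * \<epsilon>" "\<bar>grid q - z\<bar> < 2 * \<epsilon>" for p q z
  proof -
    have "\<bar>grid p - grid q\<bar> < 4 * \<epsilon>" using that by linarith
    moreover have "grid p - grid q = 4 * \<epsilon> * (real p - real q)"
      by (simp add: grid_def algebra_simps)
    ultimately have "\<bar>real p - real q\<bar> < 1" using \<open>0 < \<epsilon>\<close> by (simp add: abs_mult)
    then show ?thesis by linarith
  qed
  obtain Y where Y: "finite Y" "card Y \<le> sep_number \<theta> \<E> T \<omega> \<epsilon> n" "\<forall>x\<in>fiber \<E> \<omega>.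
      \<exists>y\<in>Y. \<forall>k<n. dist (rds_iter \<theta> T k \<omega> x) (rds_iter \<theta> T k \<omega> y) < \<epsilon>"
    using ex_spanning_set[OF compact_space \<open>0 < \<epsilon>\<close> \<open>0 < n\<close>, of \<theta> \<E> T \<omega>] by blast
  \<comment> \<open>If no grid point is near, the choice is arbitrary. It is only evaluated below
    where \<open>q c\<close> itself is near: one \<open>\<epsilon>\<close> comes from
    \<open>x\<close> to its level, the other from \<open>x\<close> to \<open>y\<close>.\<close>
  define g where "g y c = (SOME q. \<bar>grid q - F c y\<bar> < 2 * \<epsilon>)" for y c
  have "2 ^ card C * card Y \<le> 2 ^ (card \<alpha> * n) * sep_number \<theta> \<E> T \<omega> \<epsilon> n"
    using Y(2) by (simp add: \<open>card C = _\<close>)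
  then have "2 ^ card C * card Y < Q ^ Suc m" using less by (simp only: \<epsilon>_def)
  then obtain q where q: "q \<in> C \<rightarrow>\<^sub>E {..<Q}" "\<forall>y\<in>Y. card {c\<in>C. q c = g y c} \<le> m"
    using ex_few_agreements[OF \<open>finite C\<close> Y(1), of Q m g] by blast
  show ?thesis
  proof (rule cover_dim_iterated_cover_le
      [where f = f and \<eta> = \<epsilon> and \<rho> = \<rho> and \<xi> = "\<lambda>c. grid (q c)",
        OF assms(1,2) \<open>0 < \<epsilon>\<close> f])
    fix c assume "c \<in> {..<n} \<times> \<alpha>"
    then have "real (q c) \<le> real Q" using PiE_mem[OF q(1), of c] by (simp add: C_def)
    then show "\<epsilon> \<le> grid (q c) \<and> grid (q c) \<le> \<rho>"
      using \<open>0 < \<epsilon>\<close> by (simp add: grid_def \<rho>)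
  next
    fix x assume "x \<in> fiber \<E> \<omega>"
    then obtain y where y: "y \<in> Y"
        "\<And>k. k < n \<Longrightarrow> dist (rds_iter \<theta> T k \<omega> x) (rds_iter \<theta> T k \<omega> y) < \<epsilon>"
      using Y(3) by blast
    have "q c = g y c" if c: "c \<in> C" and le: "\<bar>F c x - grid (q c)\<bar> \<le> \<epsilon>" for c
    proof -
      have "\<bar>F c x - F c y\<bar> < \<epsilon>"
        using c y(2) le_less_trans[OF lebesgue_familyD(2)[OF f]] by (auto simp: C_def F_def)
      then have *: "\<bar>grid (q c) - F c y\<bar> < 2 * \<epsilon>" using le by linarith
      then have "\<bar>grid (g y c) - F c y\<bar> < 2 * \<epsilon>" unfolding g_def by (rule someI)
      then show ?thesis using * by (intro grid_inj)
    qed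
    then have sub: "{(i, A)\<in>{..<n} \<times> \<alpha>. \<bar>f A (rds_iter \<theta> T i \<omega> x) - grid (q (i, A))\<bar> \<le> \<epsilon>}
        \<subseteq> {c\<in>C. q c = g y c}"
      by (fastforce simp: C_def F_def)
    have "card {(i, A)\<in>{..<n} \<times> \<alpha>. \<bar>f A (rds_iter \<theta> T i \<omega> x) - grid (q (i, A))\<bar> \<le> \<epsilon>}
        \<le> card {c\<in>C. q c = g y c}"
      using \<open>finite C\<close> by (intro card_mono[OF _ sub]) simp
    also have "\<dots> \<le> m" using q(2) y(1) by blast
    finally show "card {(i, A)\<in>{..<n} \<times> \<alpha>.
        \<bar>f A (rds_iter \<theta> T i \<omega> x) - grid (q (i, A))\<bar> \<le> \<epsilon>} \<le> m" .
  qed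
qed

text \<open>Given \<open>\<delta>\<close>, first \<open>Q\<close> is chosen so large that
  \<open>\<delta> * ln Q\<close> dominates the exponential rate of the count, and only then the
  scale \<open>\<epsilon>\<close> determined by \<open>Q\<close>. This is not circular, since the
  entropy bound \<open>h\<close> holds at every scale.\<close>

lemma cover_dim_iterated_cover_sublinear:
  assumes reg: "regular_point \<omega>" and cov: "finite_open_cover UNIV \<alpha>"
    and fin: "Lim (at_right 0) (sep_growth \<theta> \<E> T \<omega>) < \<infinity>"
  shows "(\<lambda>n. of_nat (cover_dim (fiber \<E> \<omega>) (iterated_cover \<theta> \<E> T \<alpha> n \<omega>)) / of_nat n :: ennreal)
    \<longlonglongrightarrow> 0"
proof -
  let ?D = "\<lambda>n. cover_dim (fiber \<E> \<omega>) (iterated_cover \<theta> \<E> T \<alpha> n \<omega>)"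
  have fin\<alpha>: "finite \<alpha>" using cov by (simp add: finite_open_cover_def)
  obtain \<rho> f where f: "lebesgue_family \<alpha> \<rho> f"
    using ex_lebesgue_family[OF compact_space cov] by blast
  obtain h where h: "0 \<le> h" "Lim (at_right 0) (sep_growth \<theta> \<E> T \<omega>) = ennreal h"
    using fin by (cases "Lim (at_right 0) (sep_growth \<theta> \<E> T \<omega>)") auto
  have ev: "\<forall>\<^sub>F n in sequentially. real (?D n) \<le> \<delta> * real n" if "0 < \<delta>" for \<delta> :: real
  proof -
    \<comment> \<open>A bound for the exponential rate of \<open>2 ^ (card \<alpha> * n)\<close>
      times the separation number; the 1 is slack above the limsup.\<close>
    define b where "b = real (card \<alpha>) * ln 2 + (h + 1)"
    obtain Q :: nat where "exp (b / \<delta>) < real Q" using reals_Archimedean2 by blast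
    then have Q: "b \<le> \<delta> * ln (real Q)" "0 < Q"
    proof -
      have "0 < real Q" using \<open>exp (b / \<delta>) < real Q\<close> exp_gt_zero less_trans by blast
      then show "0 < Q" by simp
      have "b / \<delta> < ln (real Q)"
        using \<open>exp (b / \<delta>) < real Q\<close> \<open>0 < real Q\<close> by (metis exp_less_cancel_iff exp_ln)
      then show "b \<le> \<delta> * ln (real Q)" using that by (simp add: field_simps)
    qed
    define \<epsilon> where "\<epsilon> = \<rho> / (4 * real Q + 1)"
    have "0 < \<epsilon>" using lebesgue_familyD(1)[OF f] by (simp add: \<epsilon>_def add_nonneg_pos)
    have "sep_growth \<theta> \<E> T \<omega> \<epsilon> \<le> ennreal h"
      using sep_growth_le_Lim[OF compact_space \<open>0 < \<epsilon>\<close> regular_point_maps(1)[OF reg], of \<theta> T] h(2)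
      by simp
    also have "ennreal h < ennreal (h + 1)" using h(1) by (simp add: ennreal_less_iff)
    finally have "\<forall>\<^sub>F n in sequentially.
        ennreal (ln (real (sep_number \<theta> \<E> T \<omega> \<epsilon> n)) / real n) < ennreal (h + 1)"
      unfolding sep_growth_def by (rule Limsup_lessD)
    moreover have "\<forall>\<^sub>F n in sequentially. (0::nat) < n" by (rule eventually_gt_at_top)
    ultimately show ?thesis
    proof eventually_elim
      case (elim n)
      let ?s = "sep_number \<theta> \<E> T \<omega> \<epsilon> n"
      \<comment> \<open>Rounding down keeps \<open>m\<close> at most \<open>\<delta> * n\<close>,
        while the exponent \<open>Suc m\<close> still exceeds \<open>\<delta> * n\<close>.\<close>
      define m where "m = nat \<lfloor>\<delta> * real n\<rfloor>"
      have "real m = real_of_int \<lfloor>\<delta> * real n\<rfloor>" using that by (simp add: m_def)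
      then have m: "real m \<le> \<delta> * real n" "\<delta> * real n < real (Suc m)" by linarith+
      have "ln (real ?s) / real n < h + 1"
        using elim(1) h(1) by (metis ennreal_leI linorder_not_less)
      then have ln_s: "ln (real ?s) < (h + 1) * real n" using elim(2) by (simp add: field_simps)
      have "?s \<noteq> 0 \<Longrightarrow> ln (2 ^ (card \<alpha> * n) * real ?s) < ln (real Q ^ Suc m)"
      proof -
        assume "?s \<noteq> 0"
        then have "ln (2 ^ (card \<alpha> * n) * real ?s) = real (card \<alpha>) * real n * ln 2 + ln (real ?s)"
          by (simp add: ln_mult ln_realpow)
        also have "\<dots> < b * real n" using ln_s by (simp add: b_def algebra_simps)
        also have "\<dots> \<le> \<delta> * ln (real Q) * real n" using Q(1) by (intro mult_right_mono) auto
        also have "\<dots> = \<delta> * real n * ln (real Q)" by simp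
        also have "\<dots> \<le> real (Suc m) * ln (real Q)"
          using m(2) Q(2) by (intro mult_right_mono) auto
        finally show ?thesis using Q(2) by (simp add: ln_realpow del: power_Suc)
      qed
      then have "real (2 ^ (card \<alpha> * n) * ?s) < real (Q ^ Suc m)"
        using Q(2) by (cases "?s = 0") auto
      then have "2 ^ (card \<alpha> * n) * ?s < Q ^ Suc m" by (simp only: of_nat_less_iff)
      then have "?D n \<le> m"
        unfolding \<epsilon>_def
        by (rule cover_dim_le_of_sep_number_less
            [where f = f and \<rho> = \<rho> and Q = Q, OF reg fin\<alpha> elim(2) f])
      then show ?case using m(1) by linarith
    qed
  qed
  have "(\<lambda>n. real (?D n) / real n) \<longlonglongrightarrow> 0"
  proof (rule order_tendstoI)
    fix a :: real assume "a < 0"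
    then show "\<forall>\<^sub>F n in sequentially. a < real (?D n) / real n"
      by (intro always_eventually allI) (auto intro: less_le_trans)
  next
    fix a :: real assume "0 < a"
    have "\<forall>\<^sub>F n in sequentially. (0::nat) < n" by (rule eventually_gt_at_top)
    with ev[OF half_gt_zero[OF \<open>0 < a\<close>]]
    show "\<forall>\<^sub>F n in sequentially. real (?D n) / real n < a"
    proof eventually_elim
      case (elim n)
      have "real (?D n) / real n \<le> a / 2" using elim by (simp add: divide_simps)
      then show ?case using \<open>0 < a\<close> by linarith
    qed
  qed
  then have "(\<lambda>n. ennreal (real (?D n) / real n)) \<longlonglongrightarrow> ennreal 0" by (rule tendsto_ennrealI)
  moreover have "\<forall>\<^sub>F n in sequentially. ennreal (real (?D n) / real n) = of_nat (?D n) / of_nat n"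
    using eventually_gt_at_top[of 0]
    by eventually_elim (simp add: divide_ennreal[symmetric] ennreal_of_nat_eq_real_of_nat)
  ultimately show ?thesis using tendsto_cong by fastforce
qed

section \<open>Integration over the base and conclusion\<close>

text \<open>The averaged integrals are shown to converge to 0, which fixes the value of
  \<open>lim\<close>. The function \<open>h\<close> of the averaging lemma is the entropy
  integrand.\<close>

lemma mdim_cover_eq_0:
  assumes cov: "finite_open_cover UNIV \<alpha>" and fin: "top_entropy M \<theta> \<E> T < \<infinity>"
  shows "mdim_cover M \<theta> \<E> T \<alpha> = 0"
  unfolding mdim_cover_def
proof (rule limI, rule nn_integral_averages_tendsto_0)
  let ?D = "\<lambda>n \<omega>. cover_dim (fiber \<E> \<omega>) (iterated_cover \<theta> \<E> T \<alpha> n \<omega>)"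
  show "AE \<omega> in M. \<forall>n. (of_nat (?D n \<omega>) :: ennreal) \<le> of_nat (card \<alpha> * n)"
    using AE_regular_point
    by eventually_elim (use cov in \<open>intro allI of_nat_mono cover_dim_iterated_cover_le_card\<close>)
  show "AE \<omega> in M. Lim (at_right 0) (sep_growth \<theta> \<E> T \<omega>) < \<infinity> \<longrightarrow>
      (\<lambda>n. of_nat (?D n \<omega>) / of_nat n :: ennreal) \<longlonglongrightarrow> 0"
    using AE_regular_point
    by eventually_elim (use cov in \<open>intro impI cover_dim_iterated_cover_sublinear\<close>)
  show "(\<integral>\<^sup>+\<omega>. Lim (at_right 0) (sep_growth \<theta> \<E> T \<omega>) \<partial>M) < \<infinity>"
    using fin by (simp add: top_entropy_def)
qed

end

theorem corollary3p2:
  fixes M :: "'w measure"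
    and \<theta> :: "'w \<Rightarrow> 'w"
    and \<E> :: "('w \<times> 'x::metric_space) set"
    and T :: "'w \<Rightarrow> 'x \<Rightarrow> 'x"
  assumes "continuous_bundle_rds M \<theta> \<E> T"
    and "top_entropy M \<theta> \<E> T < \<infinity>"
  shows "mdim M \<theta> \<E> T = 0"
proof -
  have "mdim_cover M \<theta> \<E> T \<alpha> \<le> 0" if "finite_open_cover UNIV \<alpha>" for \<alpha>
    using continuous_bundle_rds.mdim_cover_eq_0[OF assms(1) that assms(2)] by simp
  then have "mdim M \<theta> \<E> T \<le> 0" unfolding mdim_def by (intro SUP_least) auto
  then show ?thesis by simp
qed

end
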